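(* Let $(\mathcal{M},\overset{p}{\longmapsto})$ be a target for a prefactor system $(\mathcal{M}_{\mathcal{I}},\overset{p}{\mapsto})$. For $i\in\mathcal{I}$ and $a,b\in\mathcal{M}$ define $$a\approx_i b \;:\iff\; a\overset{p}{\longmapsto}a_i \text{ and } b\overset{p}{\longmapsto}b_i \text{ for some } a_i,b_i\in\mathcal{M}_i \text{ with } a_i\asymp b_i .$$ Then $(\mathcal{M},(\approx_i)_{i\in\mathcal{I}})$ is a $\mathfrak{D}$-set.
   Context: Index sets $\mathcal{I},\mathcal{J},\dots$ are non-empty directed preordered sets (products carry the product order). For each index set $\mathcal{I}$ (including products) a set $\mathfrak{D}(\mathcal{I})\subseteq\mathcal{P}(\mathcal{I})$ is fixed. Standing assumptions: $\mathfrak{D}(\mathcal{I})$ is a proper filter of subsets of $\mathcal{I}$, all of whose members are cofinal, and it contains all non-empty up-sets; and if $\mathcal{H}\in\mathfrak{D}(\mathcal{I}\times\mathcal{J})$ and $\mathcal{I}'\in\mathfrak{D}(\mathcal{I})$, then $\{j\in\mathcal{J}\mid\exists i\in\mathcal{I}'\ (i,j)\in\mathcal{H}\}\in\mathfrak{D}(\mathcal{J})$. A system $(\mathcal{M}_{\mathcal{I}},\overset{p}{\mapsto})$ is a family of finite sets $(\mathcal{M}_i)_{i\in\mathcal{I}}$ (regarded as disjoint) with relations $\overset{p}{\mapsto}\subseteq\mathcal{M}_{i'}\times\mathcal{M}_i$ for $i'\ge i$, reflexive for $i=i'$. Elements $a_i\in\mathcal{M}_i$, $b_j\in\mathcal{M}_j$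 are consistent, $a_i\asymp b_j$, iff there are $i'\ge i,j$ and $a_{i'}\in\mathcal{M}_{i'}$ with $a_{i'}\overset{p}{\mapsto}a_i$ and $a_{i'}\overset{p}{\mapsto}b_j$. A prefactor system is a system with $a_{i'}\asymp a_i\iff a_{i'}\overset{p}{\mapsto}a_i$ for all $i\le i'$, $a_i\in\mathcal{M}_i$, $a_{i'}\in\mathcal{M}_{i'}$. A target for a prefactor system is a set $\mathcal{M}$ with relations $\overset{p}{\longmapsto}\subseteq\mathcal{M}\times\mathcal{M}_i$ ($i\in\mathcal{I}$) such that $\{i\in\mathcal{I}\mid\exists a_i\in\mathcal{M}_i\ a\overset{p}{\longmapsto}a_i\}\in\mathfrak{D}(\mathcal{I})$ for all $a\in\mathcal{M}$, and $a\overset{p}{\longmapsto}a_{i'}$, $a\overset{p}{\longmapsto}a_i$ imply $a_{i'}\overset{p}{\mapsto}a_i$ for all $i\le i'$. For a family $\approx_{\mathcal{I}}=(\approx_i)_{i\in\mathcal{I}}$ of partial equivalence relations (PERs: symmetric and transitive) on $\mathcal{M}$ put $[i]:=\{a\in\mathcal{M}\mid a\approx_i a\}$ and $\mathcal{I}_a:=\{i\in\mathcal{I}\mid a\in[i]\}$. $(\mathcal{M},\approx_{\mathcal{I}})$ is a $\mathfrak{D}$-set iff each $\approx_i$ is a PER on $\mathcal{M}$; it is dense, i.e. $\mathcal{I}_a\in\mathfrak{D}(\mathcal{I})$ for all $a\in\mathcal{M}$; and it is approximating, i.e. $a\approx_{i'}b$ and $a,b\in[i]$ imply $a\approx_i b$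 for all $i\le i'$, $a,b\in\mathcal{M}$. *)

theory Defs
  imports Main
begin

text \<open>
  A preordered index set is represented by its order relation \<open>r\<close>, where \<open>(i, i') \<in> r\<close>
  means \<open>i \<le> i'\<close>; the underlying set is \<open>Field r\<close> (no information is lost, since \<open>r\<close> is reflexive).

  The assignment of a family of subsets to \<^emph>\<open>every\<close> index set, products included, needs a type of
  indices that is closed under pairing. The type below is the free such type over arbitrary
  atoms, so every index set with elements in \<open>'u\<close> occurs in it via \<open>Atom\<close>.
\<close>

datatype 'u idx = Atom 'u | IPair "'u idx" "'u idx"

definition index_set :: "'i rel \<Rightarrow> bool" where
  "index_set r \<longleftrightarrow> Preorder r \<and> Field r \<noteq> {} \<and>
     (\<forall>i\<in>Field r. \<forall>j\<in>Field r. \<exists>k\<in>Field r. (i, k) \<in> r \<and> (j, k) \<in> r)"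

definition prod_order :: "'u idx rel \<Rightarrow> 'u idx rel \<Rightarrow> 'u idx rel" where
  "prod_order r s = {(IPair i j, IPair i' j') | i i' j j'. (i, i') \<in> r \<and> (j, j') \<in> s}"

text \<open>Unlike the constant \<open>cofinal\<close> of the cardinals library, no strict upper bounds are required.\<close>

definition cofinal_in :: "'i rel \<Rightarrow> 'i set \<Rightarrow> bool" where
  "cofinal_in r H \<longleftrightarrow> H \<subseteq> Field r \<and> (\<forall>i\<in>Field r. \<exists>h\<in>H. (i, h) \<in> r)"

definition up_set :: "'i rel \<Rightarrow> 'i set \<Rightarrow> bool" where
  "up_set r U \<longleftrightarrow> U \<subseteq> Field r \<and> (\<forall>i\<in>U. \<forall>i'. (i, i') \<in> r \<longrightarrow> i' \<in> U)"

definition proper_filter_on :: "'i set \<Rightarrow> 'i set set \<Rightarrow> bool" where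
  "proper_filter_on I F \<longleftrightarrow> F \<subseteq> Pow I \<and> I \<in> F \<and> {} \<notin> F \<and>
     (\<forall>A\<in>F. \<forall>B\<in>F. A \<inter> B \<in> F) \<and>
     (\<forall>A\<in>F. \<forall>B. A \<subseteq> B \<and> B \<subseteq> I \<longrightarrow> B \<in> F)"

definition dense_assignment :: "('u idx rel \<Rightarrow> 'u idx set set) \<Rightarrow> bool" where
  "dense_assignment \<DD> \<longleftrightarrow>
     (\<forall>r. index_set r \<longrightarrow>
        proper_filter_on (Field r) (\<DD> r) \<and>
        (\<forall>H\<in>\<DD> r. cofinal_in r H) \<and>
        (\<forall>U. up_set r U \<and> U \<noteq> {} \<longrightarrow> U \<in> \<DD> r)) \<and>
     (\<forall>r s. index_set r \<and> index_set s \<longrightarrow>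
        (\<forall>H\<in>\<DD> (prod_order r s). \<forall>I'\<in>\<DD> r.
           {j \<in> Field s. \<exists>i\<in>I'. IPair i j \<in> H} \<in> \<DD> s))"

text \<open>
  In a system \<open>(M, p)\<close>, \<open>(a', a) \<in> p i' i\<close> renders the relation between \<open>a' \<in> M i'\<close> and \<open>a \<in> M i\<close>.
  Indexing it by both \<open>i'\<close> and \<open>i\<close> amounts to regarding the sets \<open>M i\<close> as disjoint.
  The values \<open>p i' i\<close> are relevant only for \<open>(i, i') \<in> r\<close>.
\<close>

definition system ::
  "'i rel \<Rightarrow> ('i \<Rightarrow> 'm set) \<Rightarrow> ('i \<Rightarrow> 'i \<Rightarrow> ('m \<times> 'm) set) \<Rightarrow> bool" where
  "system r M p \<longleftrightarrow>
     (\<forall>i\<in>Field r. finite (M i)) \<and>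
     (\<forall>i i'. (i, i') \<in> r \<longrightarrow> p i' i \<subseteq> M i' \<times> M i) \<and>
     (\<forall>i\<in>Field r. refl_on (M i) (p i i))"

definition consistent ::
  "'i rel \<Rightarrow> ('i \<Rightarrow> 'm set) \<Rightarrow> ('i \<Rightarrow> 'i \<Rightarrow> ('m \<times> 'm) set) \<Rightarrow> 'i \<Rightarrow> 'm \<Rightarrow> 'i \<Rightarrow> 'm \<Rightarrow> bool" where
  "consistent r M p i a j b \<longleftrightarrow>
     (\<exists>k. (i, k) \<in> r \<and> (j, k) \<in> r \<and> (\<exists>c\<in>M k. (c, a) \<in> p k i \<and> (c, b) \<in> p k j))"

definition prefactor_system ::
  "'i rel \<Rightarrow> ('i \<Rightarrow> 'm set) \<Rightarrow> ('i \<Rightarrow> 'i \<Rightarrow> ('m \<times> 'm) set) \<Rightarrow> bool" where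
  "prefactor_system r M p \<longleftrightarrow> system r M p \<and>
     (\<forall>i i'. (i, i') \<in> r \<longrightarrow>
        (\<forall>a\<in>M i. \<forall>a'\<in>M i'. consistent r M p i' a' i a \<longleftrightarrow> (a', a) \<in> p i' i))"

definition target ::
  "('i rel \<Rightarrow> 'i set set) \<Rightarrow> 'i rel \<Rightarrow> ('i \<Rightarrow> 'm set) \<Rightarrow> ('i \<Rightarrow> 'i \<Rightarrow> ('m \<times> 'm) set) \<Rightarrow>
   't set \<Rightarrow> ('i \<Rightarrow> ('t \<times> 'm) set) \<Rightarrow> bool" where
  "target \<DD> r M p T q \<longleftrightarrow>
     (\<forall>i\<in>Field r. q i \<subseteq> T \<times> M i) \<and>
     (\<forall>a\<in>T. {i \<in> Field r. \<exists>x\<in>M i. (a, x) \<in> q i} \<in> \<DD> r) \<and>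
     (\<forall>i i'. (i, i') \<in> r \<longrightarrow>
        (\<forall>a\<in>T. \<forall>x\<in>M i. \<forall>x'\<in>M i'. (a, x') \<in> q i' \<and> (a, x) \<in> q i \<longrightarrow> (x', x) \<in> p i' i))"

definition per_on :: "'t set \<Rightarrow> 't rel \<Rightarrow> bool" where
  "per_on T E \<longleftrightarrow> E \<subseteq> T \<times> T \<and> sym E \<and> trans E"

definition cell :: "'t set \<Rightarrow> ('i \<Rightarrow> 't rel) \<Rightarrow> 'i \<Rightarrow> 't set" where
  "cell T E i = {a \<in> T. (a, a) \<in> E i}"

definition indices_of :: "'i rel \<Rightarrow> 't set \<Rightarrow> ('i \<Rightarrow> 't rel) \<Rightarrow> 't \<Rightarrow> 'i set" where
  "indices_of r T E a = {i \<in> Field r. a \<in> cell T E i}"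

definition D_set :: "('i rel \<Rightarrow> 'i set set) \<Rightarrow> 'i rel \<Rightarrow> 't set \<Rightarrow> ('i \<Rightarrow> 't rel) \<Rightarrow> bool" where
  "D_set \<DD> r T E \<longleftrightarrow>
     (\<forall>i\<in>Field r. per_on T (E i)) \<and>
     (\<forall>a\<in>T. indices_of r T E a \<in> \<DD> r) \<and>
     (\<forall>i i'. (i, i') \<in> r \<longrightarrow>
        (\<forall>a\<in>T. \<forall>b\<in>T. (a, b) \<in> E i' \<and> a \<in> cell T E i \<and> b \<in> cell T E i \<longrightarrow> (a, b) \<in> E i))"

definition target_approx ::
  "'i rel \<Rightarrow> ('i \<Rightarrow> 'm set) \<Rightarrow> ('i \<Rightarrow> 'i \<Rightarrow> ('m \<times> 'm) set) \<Rightarrow>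
   't set \<Rightarrow> ('i \<Rightarrow> ('t \<times> 'm) set) \<Rightarrow> 'i \<Rightarrow> 't rel" where
  "target_approx r M p T q i = {(a, b). a \<in> T \<and> b \<in> T \<and>
     (\<exists>x\<in>M i. \<exists>y\<in>M i. (a, x) \<in> q i \<and> (b, y) \<in> q i \<and> consistent r M p i x i y)}"

end

theory Submission
  imports Defs
begin

text \<open>
  An element \<open>c\<close> with \<open>c \<mapsto> a\<close> and \<open>c \<mapsto> b\<close> witnesses \<open>a \<asymp> b\<close>, and in a prefactor system \<open>a \<asymp> b\<close>
  amounts to \<open>a \<mapsto> b\<close> when the indices are comparable. Hence \<open>\<mapsto>\<close> is an equivalence relation on
  each \<open>M i\<close>, which makes \<open>\<approx>\<^sub>i\<close> a PER. For the approximation property, let \<open>a\<close> have the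
  prefactors \<open>x' \<in> M i'\<close> and \<open>x \<in> M i\<close>, and \<open>b\<close> the prefactors \<open>y'\<close> and \<open>y\<close>, with \<open>x' \<asymp> y'\<close>.
  Then \<open>x'\<close> witnesses \<open>y' \<asymp> x\<close>, so \<open>y' \<mapsto> x\<close>, and now \<open>y'\<close> witnesses \<open>x \<asymp> y\<close>.
\<close>

lemma consistentI:
  assumes "(i, k) \<in> r" "(j, k) \<in> r" "c \<in> M k" "(c, a) \<in> p k i" "(c, b) \<in> p k j"
  shows "consistent r M p i a j b"
  using assms unfolding consistent_def by blast

lemma consistent_sym:
  "consistent r M p i a j b \<Longrightarrow> consistent r M p j b i a"
  unfolding consistent_def by blast

lemma index_set_refl: "index_set r \<Longrightarrow> i \<in> Field r \<Longrightarrow> (i, i) \<in> r"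
  unfolding index_set_def preorder_on_def refl_on_def by blast

lemma prefactor_system_consistent_iff:
  assumes "prefactor_system r M p" "(i, i') \<in> r" "a \<in> M i" "a' \<in> M i'"
  shows "consistent r M p i' a' i a \<longleftrightarrow> (a', a) \<in> p i' i"
  using assms unfolding prefactor_system_def by blast

lemma prefactor_system_refl:
  assumes "prefactor_system r M p" "i \<in> Field r" "a \<in> M i"
  shows "(a, a) \<in> p i i"
  using assms unfolding prefactor_system_def system_def refl_on_def by blast

lemma consistent_refl:
  assumes "index_set r" "prefactor_system r M p" "i \<in> Field r" "a \<in> M i"
  shows "consistent r M p i a i a"
  using prefactor_system_consistent_iff[OF assms(2) index_set_refl[OF assms(1,3)] assms(4,4)]
    prefactor_system_refl[OF assms(2-4)] by blast

text \<open>The common core of transitivity and approximation: the case \<open>i' = i\<close> gives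
  transitivity of consistency at a single index, while arbitrary \<open>i \<le> i'\<close> carries
  consistency down from \<open>i'\<close> to \<open>i\<close>.\<close>

lemma consistent_transfer:
  assumes P: "prefactor_system r M p" and ii': "(i, i') \<in> r" "(i', i') \<in> r"
    and mem: "x' \<in> M i'" "y' \<in> M i'" "x \<in> M i"
    and "consistent r M p i' x' i' y'" "(x', x) \<in> p i' i" "(y', y) \<in> p i' i"
  shows "consistent r M p i x i y"
proof -
  have "(x', y') \<in> p i' i'"
    using prefactor_system_consistent_iff[OF P ii'(2) mem(2,1)] assms(7) by blast
  with ii'(2) ii'(1) mem(1) have "consistent r M p i' y' i x"
    using assms(8) by (rule consistentI)
  then have "(y', x) \<in> p i' i"
    using prefactor_system_consistent_iff[OF P ii'(1) mem(3,2)] by blast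
  with ii'(1) ii'(1) mem(2) show ?thesis
    using assms(9) by (rule consistentI)
qed

lemma consistent_trans:
  assumes I: "index_set r" and P: "prefactor_system r M p" and i: "i \<in> Field r"
    and mem: "x \<in> M i" "y \<in> M i" "z \<in> M i"
    and "consistent r M p i x i y" "consistent r M p i y i z"
  shows "consistent r M p i x i z"
proof -
  have ii: "(i, i) \<in> r"
    using I i by (rule index_set_refl)
  have "(y, z) \<in> p i i"
    using prefactor_system_consistent_iff[OF P ii mem(3,2)] assms(8) by blast
  \<comment> \<open>The transfer is applied with \<open>i' = i\<close>: \<open>x\<close> is sent to
    itself by reflexivity, and \<open>y\<close> is sent to \<open>z\<close>.\<close>
  then show ?thesis
    using consistent_transfer[OF P ii ii mem(1,2,1) assms(7) prefactor_system_refl[OF P i mem(1)]]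
    by blast
qed

lemma target_compatible:
  assumes "target \<DD> r M p T q" "(i, i') \<in> r" "a \<in> T" "x \<in> M i" "x' \<in> M i'"
    "(a, x') \<in> q i'" "(a, x) \<in> q i"
  shows "(x', x) \<in> p i' i"
  using assms unfolding target_def by blast

lemma target_approxE:
  assumes "(a, b) \<in> target_approx r M p T q i"
  obtains x y where "a \<in> T" "b \<in> T" "x \<in> M i" "y \<in> M i" "(a, x) \<in> q i" "(b, y) \<in> q i"
    "consistent r M p i x i y"
  using assms unfolding target_approx_def by blast

lemma target_approxI:
  assumes "a \<in> T" "b \<in> T" "x \<in> M i" "y \<in> M i" "(a, x) \<in> q i" "(b, y) \<in> q i"
    "consistent r M p i x i y"
  shows "(a, b) \<in> target_approx r M p T q i"
  using assms unfolding target_approx_def by blast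

lemma per_on_target_approx:
  assumes I: "index_set r" and P: "prefactor_system r M p" and tgt: "target \<DD> r M p T q"
    and i: "i \<in> Field r"
  shows "per_on T (target_approx r M p T q i)"
  unfolding per_on_def
proof (intro conjI)
  show "target_approx r M p T q i \<subseteq> T \<times> T"
    unfolding target_approx_def by blast
  show "sym (target_approx r M p T q i)"
    by (rule symI, erule target_approxE) (blast intro: target_approxI consistent_sym)
  show "trans (target_approx r M p T q i)"
  proof (rule transI)
    fix a b c
    assume "(a, b) \<in> target_approx r M p T q i" "(b, c) \<in> target_approx r M p T q i"
    then obtain x y y' z where T: "a \<in> T" "b \<in> T" "c \<in> T"
      and mem: "x \<in> M i" "y \<in> M i" "y' \<in> M i" "z \<in> M i"
      and q: "(a, x) \<in> q i" "(b, y) \<in> q i" "(b, y') \<in> q i" "(c, z) \<in> q i"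
      and xy: "consistent r M p i x i y" and y'z: "consistent r M p i y' i z"
      by (elim target_approxE)
    have ii: "(i, i) \<in> r"
      using I i by (rule index_set_refl)
    \<comment> \<open>The two hypotheses may supply different prefactors \<open>y\<close> and
      \<open>y'\<close> of \<open>b\<close>. Compatibility of the target at \<open>i \<le> i\<close>
      relates them, which closes the chain from \<open>x\<close> to \<open>z\<close>.\<close>
    have "(y, y') \<in> p i i"
      using target_compatible[OF tgt ii T(2)] mem q by blast
    then have "consistent r M p i y i y'"
      using prefactor_system_consistent_iff[OF P ii] mem by blast
    then have "consistent r M p i x i z"
      using consistent_trans[OF I P i] mem xy y'z by meson
    then show "(a, c) \<in> target_approx r M p T q i"
      using T mem q by (intro target_approxI)
  qed
qed

text \<open>Any prefactor of \<open>a\<close> in \<open>M i\<close> is consistent with itself and so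
  already puts \<open>a\<close> into the cell at \<open>i\<close>. This turns density into the first
  condition on a target.\<close>

lemma indices_of_target_approx:
  assumes "index_set r" "prefactor_system r M p" "a \<in> T"
  shows "indices_of r T (target_approx r M p T q) a = {i \<in> Field r. \<exists>x\<in>M i. (a, x) \<in> q i}"
  using assms(3) consistent_refl[OF assms(1,2)]
  unfolding indices_of_def cell_def target_approx_def by blast

lemma target_approx_approximating:
  assumes I: "index_set r" and P: "prefactor_system r M p" and tgt: "target \<DD> r M p T q"
    and ii': "(i, i') \<in> r" and ab: "(a, b) \<in> target_approx r M p T q i'"
    and cells: "a \<in> cell T (target_approx r M p T q) i" "b \<in> cell T (target_approx r M p T q) i"
  shows "(a, b) \<in> target_approx r M p T q i"
proof -
  from ab obtain x' y' where T: "a \<in> T" "b \<in> T" and mem': "x' \<in> M i'" "y' \<in> M i'"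
    and q': "(a, x') \<in> q i'" "(b, y') \<in> q i'" and xy': "consistent r M p i' x' i' y'"
    by (rule target_approxE)
  \<comment> \<open>The cells provide prefactors at \<open>i\<close>; their consistency is then
    inherited from \<open>x'\<close> and \<open>y'\<close> at \<open>i'\<close>.\<close>
  from cells obtain x y where mem: "x \<in> M i" "y \<in> M i" and q: "(a, x) \<in> q i" "(b, y) \<in> q i"
    unfolding cell_def target_approx_def by blast
  have i'i': "(i', i') \<in> r"
    using I ii' by (blast intro: index_set_refl FieldI2)
  have "(x', x) \<in> p i' i" "(y', y) \<in> p i' i"
    using target_compatible[OF tgt ii'] T mem mem' q q' by blast+
  then have "consistent r M p i x i y"
    using consistent_transfer[OF P ii' i'i'] mem' mem xy' by blast
  then show ?thesis
    using T mem q by (intro target_approxI)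
qed

theorem lemma3p2:
  fixes \<DD> :: "'u idx rel \<Rightarrow> 'u idx set set"
    and r :: "'u idx rel"
    and M :: "'u idx \<Rightarrow> 'm set"
    and p :: "'u idx \<Rightarrow> 'u idx \<Rightarrow> ('m \<times> 'm) set"
    and T :: "'t set"
    and q :: "'u idx \<Rightarrow> ('t \<times> 'm) set"
  assumes "dense_assignment \<DD>"
    and "index_set r"
    and "prefactor_system r M p"
    and "target \<DD> r M p T q"
  shows "D_set \<DD> r T (target_approx r M p T q)"
  unfolding D_set_def
proof (intro conjI ballI allI impI)
  show "per_on T (target_approx r M p T q i)" if "i \<in> Field r" for i
    using assms(2-4) that by (rule per_on_target_approx)
  show "indices_of r T (target_approx r M p T q) a \<in> \<DD> r" if "a \<in> T" for a
    using assms(4) that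
    unfolding indices_of_target_approx[OF assms(2,3) that] target_def by blast
  show "(a, b) \<in> target_approx r M p T q i"
    if "(i, i') \<in> r" and "(a, b) \<in> target_approx r M p T q i' \<and>
      a \<in> cell T (target_approx r M p T q) i \<and> b \<in> cell T (target_approx r M p T q) i"
    for i i' a b
    using that target_approx_approximating[OF assms(2-4)] by blast
qed

end
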